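(* Let $S$ be a finite semigroup. Then $\mathbf{C}(S)$ is a right zero semigroup (i.e. satisfies $xy=y$ for all $x,y$) if and only if $abc=ac$ for all $a,b,c\in S$.
   Context: Cayley automaton semigroup: for a finite (non-empty) semigroup $S$, the Cayley automaton $\mathcal{C}(S)$ has state set $S$ and alphabet $S$; when in state $s$ (written $\overline{s}$ to distinguish states from symbols) and reading a symbol $t$, it outputs $st$ and moves to state $\overline{st}$. Thus each state defines a transformation $\overline{s}$ of the set $S^{\infty}$ of infinite sequences over $S$, given by $(x_1,x_2,x_3,\ldots)\cdot\overline{s}=(sx_1,\,sx_1x_2,\,sx_1x_2x_3,\ldots)$. Transformations act on the right and are composed left to right: $\alpha\cdot(\overline{s}\cdot\overline{t})=(\alpha\cdot\overline{s})\cdot\overline{t}$. $\mathbf{C}(S)$ is the semigroup of transformations of $S^{\infty}$ generated by $\{\overline{s}:s\in S\}$. *)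

theory Defs
  imports Main "HOL-Library.Stream"
begin

text \<open>
  The letter-to-letter transformation of infinite words computed by a Mealy automaton with
  transition function \<open>\<delta>\<close> and output function \<open>out\<close>, started in state \<open>q\<close>.
\<close>

primcorec mealy_run :: "('q \<Rightarrow> 'a \<Rightarrow> 'q) \<Rightarrow> ('q \<Rightarrow> 'a \<Rightarrow> 'b) \<Rightarrow> 'q \<Rightarrow> 'a stream \<Rightarrow> 'b stream" where
  "mealy_run \<delta> out q xs = out q (shd xs) ## mealy_run \<delta> out (\<delta> q (shd xs)) (stl xs)"

text \<open>
  The semigroup \<open>S\<close> is the whole type \<open>'a\<close>, which serves both as state set and as alphabet of
  the Cayley automaton; the new state and the output symbol are both \<open>s * t\<close>.
\<close>

definition cayley_state :: "'a::semigroup_mult \<Rightarrow> 'a stream \<Rightarrow> 'a stream" where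
  "cayley_state = mealy_run (\<lambda>s t. s * t) (\<lambda>s t. s * t)"

text \<open>The explicit form \<open>(x\<^sub>1, x\<^sub>2, \<dots>) \<mapsto> (s x\<^sub>1, s x\<^sub>1 x\<^sub>2, \<dots>)\<close>.\<close>

lemma snth_cayley_state: "cayley_state s xs !! n = foldl (*) s (stake (Suc n) xs)"
  by (induction n arbitrary: s xs) (simp_all add: cayley_state_def)

text \<open>Transformations act on the right: in \<open>f \<cdot> g\<close>, the map \<open>f\<close> is applied first.\<close>

definition transf_mult :: "('x \<Rightarrow> 'x) \<Rightarrow> ('x \<Rightarrow> 'x) \<Rightarrow> 'x \<Rightarrow> 'x" where
  "transf_mult f g = (\<lambda>\<alpha>. g (f \<alpha>))"

inductive_set generated_transf_semigroup :: "('x \<Rightarrow> 'x) set \<Rightarrow> ('x \<Rightarrow> 'x) set"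
  for G :: "('x \<Rightarrow> 'x) set" where
  generator: "f \<in> G \<Longrightarrow> f \<in> generated_transf_semigroup G"
| mult: "f \<in> generated_transf_semigroup G \<Longrightarrow> g \<in> generated_transf_semigroup G
    \<Longrightarrow> transf_mult f g \<in> generated_transf_semigroup G"

definition cayley_automaton_semigroup :: "('a::semigroup_mult stream \<Rightarrow> 'a stream) set" where
  "cayley_automaton_semigroup = generated_transf_semigroup (range cayley_state)"

definition right_zero_semigroup :: "'x set \<Rightarrow> ('x \<Rightarrow> 'x \<Rightarrow> 'x) \<Rightarrow> bool" where
  "right_zero_semigroup T m \<longleftrightarrow>
     (\<forall>x\<in>T. \<forall>y\<in>T. m x y \<in> T) \<and>
     (\<forall>x\<in>T. \<forall>y\<in>T. \<forall>z\<in>T. m (m x y) z = m x (m y z)) \<and>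
     (\<forall>x\<in>T. \<forall>y\<in>T. m x y = y)"

end

theory Submission imports Defs begin

text \<open>
  Comparing first letters in \<open>s\<cdot>t = t\<close> gives \<open>t s x = t x\<close>. Conversely, under
  \<open>a b c = a c\<close> the state \<open>s\<close> acts letterwise as left multiplication by \<open>s\<close>, so the
  states already form a right zero semigroup.
\<close>

lemma cayley_state_simps [simp]:
  "shd (cayley_state s xs) = s * shd xs"
  "stl (cayley_state s xs) = cayley_state (s * shd xs) (stl xs)"
  by (simp_all add: cayley_state_def)

text \<open>Reading \<open>x\<close> moves state \<open>s\<close> to \<open>s * x\<close>, but
  \<open>s * x * y = s * y\<close>, so the move never shows in a later output.\<close>

lemma cayley_state_eq_smap:
  fixes s :: "'a::semigroup_mult"
  assumes "\<And>a b c :: 'a. a * b * c = a * c"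
  shows "cayley_state s xs = smap ((*) s) xs"
proof -
  have state_cong: "cayley_state (s * x) ys = cayley_state s ys" for s x :: 'a and ys
    \<comment> \<open>After one letter both runs are in state \<open>s * shd ys\<close>, so the
      tails are equal; the strong rule accepts this.\<close>
    by (coinduction arbitrary: s x ys rule: stream.coinduct_strong) (simp add: assms)
  show ?thesis
    by (coinduction arbitrary: xs) (auto simp: state_cong)
qed

lemma transf_mult_cayley_state:
  fixes s t :: "'a::semigroup_mult"
  assumes "\<And>a b c :: 'a. a * b * c = a * c"
  shows "transf_mult (cayley_state s) (cayley_state t) = cayley_state t"
proof
  fix xs
  have "t * (s * x) = t * x" for x
    by (metis assms mult.assoc)
  then show "transf_mult (cayley_state s) (cayley_state t) xs = cayley_state t xs"
    by (simp add: transf_mult_def cayley_state_eq_smap[OF assms] stream.map_comp o_def)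
qed

text \<open>A product of two states is its right factor, so the generators are closed under
  composition.\<close>

lemma cayley_automaton_semigroup_eq_range:
  assumes "\<And>a b c :: 'a::semigroup_mult. a * b * c = a * c"
  shows "cayley_automaton_semigroup = range (cayley_state :: 'a \<Rightarrow> _)"
proof
  show "cayley_automaton_semigroup \<subseteq> range (cayley_state :: 'a \<Rightarrow> _)"
  proof
    fix f :: "'a stream \<Rightarrow> 'a stream"
    assume "f \<in> cayley_automaton_semigroup"
    then show "f \<in> range cayley_state"
      unfolding cayley_automaton_semigroup_def
      by induction (auto simp: transf_mult_cayley_state[OF assms])
  qed
qed (auto simp: cayley_automaton_semigroup_def intro: generated_transf_semigroup.generator)

theorem proposition1p5:
  shows "right_zero_semigroup
           (cayley_automaton_semigroup :: ('a::{semigroup_mult, finite} stream \<Rightarrow> 'a stream) set)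
           transf_mult
         \<longleftrightarrow> (\<forall>a b c :: 'a. a * b * c = a * c)"
proof
  assume rz: "right_zero_semigroup
    (cayley_automaton_semigroup :: ('a stream \<Rightarrow> 'a stream) set) transf_mult"
  show "\<forall>a b c :: 'a. a * b * c = a * c"
  proof (intro allI)
    fix a b c :: 'a
    have "cayley_state s \<in> cayley_automaton_semigroup" for s :: 'a
      by (simp add: cayley_automaton_semigroup_def generated_transf_semigroup.generator)
    then have "transf_mult (cayley_state b) (cayley_state a) = cayley_state a"
      using rz by (simp add: right_zero_semigroup_def)
    \<comment> \<open>The left factor \<open>b\<close> acts first, hence is the inner map. Any
      stream with head \<open>c\<close> would serve; the first letters are
      \<open>a * (b * c)\<close> and \<open>a * c\<close>.\<close>
    then have "shd (cayley_state a (cayley_state b (sconst c))) = shd (cayley_state a (sconst c))"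
      by (simp add: transf_mult_def fun_eq_iff)
    then show "a * b * c = a * c"
      by (simp add: mult.assoc)
  qed
next
  assume "\<forall>a b c :: 'a. a * b * c = a * c"
  then have abc: "\<And>a b c :: 'a. a * b * c = a * c" by blast
  show "right_zero_semigroup
    (cayley_automaton_semigroup :: ('a stream \<Rightarrow> 'a stream) set) transf_mult"
    by (auto simp: right_zero_semigroup_def cayley_automaton_semigroup_eq_range[OF abc]
        transf_mult_cayley_state[OF abc])
qed

end
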